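(* Let $(S,+,\cdot)$ be a weak ring. Let $\mathcal{F}$ be a family of subsets of $S$ with the Ramsey property which is left inverse shift invariant (with respect to $+$) and dilation invariant and such that $\beta(\mathcal{F})$ is a subsemigroup of $(\beta S,+)$. Let $\langle x_n\rangle_{n=1}^{\infty}$ be an $\mathcal{F}$-minimal sequence in $(S,+)$ and let $A$ be an essential $\mathcal{F}^{\star}$-set in $(S,+)$. Then there exists a sum subsystem $\langle y_n\rangle_{n=1}^{\infty}$ of $\langle x_n\rangle_{n=1}^{\infty}$ such that $$FS(\langle y_n\rangle_{n=1}^{\infty})\cup AP(\langle y_n\rangle_{n=1}^{\infty})\subseteq A.$$
   Context: A weak ring is a triple $(S,+,\cdot)$ such that $(S,+)$ and $(S,\cdot)$ are semigroups (neither assumed commutative) and both distributive laws hold: $x\cdot(y+z)=x\cdot y+x\cdot z$ and $(x+y)\cdot z=x\cdot z+y\cdot z$ for all $x,y,z\in S$. A family on $S$ is a non-empty collection $\mathcal{F}\subseteq\mathcal{P}(S)\setminus\{\emptyset\}$ closed under supersets within $S$. $\mathcal{F}$ has the Ramsey property if whenever $A\in\mathcal{F}$ and $A=A_1\cup A_2$, some $A_i\in\mathcal{F}$. $\mathcal{F}$ is left inverse shift invariant (with respect to $+$) if $-s+E=\{y\in S: s+y\in E\}\in\mathcal{F}$ for all $s\in S$, $E\in\mathcal{F}$. $\mathcal{F}$ is dilation invariant if $sE=\{s\cdot y:y\in E\}\in\mathcal{F}$ and $Es=\{y\cdot s:y\in E\}\in\mathcal{F}$ for all $s\in S$, $E\in\mathcal{F}$.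 $\beta S$ is the set of ultrafilters on $S$ (Stone-Čech compactification of discrete $S$) with $A\in p+q$ iff $\{x\in S: -x+A\in q\}\in p$. Put $\beta(\mathcal{F})=\{p\in\beta S: p\subseteq\mathcal{F}\}$. A set $A\subseteq S$ is an essential $\mathcal{F}^{\star}$-set in $(S,+)$ if $A\in p$ for every idempotent $p$ of $(\beta(\mathcal{F}),+)$. For a sequence in $S$, $FS(\langle x_n\rangle_{n=m}^{\infty})$ is the set of all sums $\sum_{n\in F}x_n$, taken in increasing order of indices, over non-empty finite $F\subseteq\{m,m+1,\dots\}$. $AP(\langle x_n\rangle_{n=1}^{\infty})$ is the set of all products of finitely many (at least one) terms of the sequence in any order with no repetitions, i.e. all $x_{n_1}\cdot x_{n_2}\cdots x_{n_k}$ with $k\ge 1$ and $n_1,\dots,n_k\in\mathbb{N}$ distinct. The sequence is $\mathcal{F}$-minimal in $(S,+)$ if $\bigcap_{m=1}^{\infty}\mathrm{cl}(FS(\langle x_n\rangle_{n=m}^{\infty}))\cap\beta(\mathcal{F})\neq\emptyset$, where $\mathrm{cl}(B)=\{p\in\beta S: B\in p\}$. A sequence $\langle y_n\rangle_{n=1}^{\infty}$ is a sum subsystem of $\langle x_n\rangle_{n=1}^{\infty}$ if there are non-empty finite sets $H_n\subseteq\mathbb{N}$ with $\max H_n<\min H_{n+1}$ and $y_n=\sum_{t\in H_n}x_t$ (in increasing order of indices) for each $n\in\mathbb{N}$. *)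

theory Defs
  imports Main
begin

text \<open>
  The carrier \<open>S\<close> is the whole type. Unlike the library class \<^class>\<open>semiring\<close>,
  addition is not assumed commutative.
\<close>

class weak_ring = semigroup_add + semigroup_mult +
  assumes weak_ring_distrib_left: "a * (b + c) = a * b + a * c"
    and weak_ring_distrib_right: "(a + b) * c = a * c + b * c"

definition is_family :: "'a set set \<Rightarrow> bool" where
  "is_family F \<longleftrightarrow> F \<noteq> {} \<and> {} \<notin> F \<and> (\<forall>A B. A \<in> F \<and> A \<subseteq> B \<longrightarrow> B \<in> F)"

definition ramsey_property :: "'a set set \<Rightarrow> bool" where
  "ramsey_property F \<longleftrightarrow>
     (\<forall>A A1 A2. A \<in> F \<and> A = A1 \<union> A2 \<longrightarrow> A1 \<in> F \<or> A2 \<in> F)"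

definition left_inverse_shift_invariant :: "'a::semigroup_add set set \<Rightarrow> bool" where
  "left_inverse_shift_invariant F \<longleftrightarrow> (\<forall>s. \<forall>E\<in>F. {y. s + y \<in> E} \<in> F)"

definition dilation_invariant :: "'a::semigroup_mult set set \<Rightarrow> bool" where
  "dilation_invariant F \<longleftrightarrow>
     (\<forall>s. \<forall>E\<in>F. (\<lambda>y. s * y) ` E \<in> F \<and> (\<lambda>y. y * s) ` E \<in> F)"

definition is_ultrafilter :: "'a set set \<Rightarrow> bool" where
  "is_ultrafilter p \<longleftrightarrow>
     UNIV \<in> p \<and> {} \<notin> p \<and>
     (\<forall>A B. A \<in> p \<and> A \<subseteq> B \<longrightarrow> B \<in> p) \<and>
     (\<forall>A B. A \<in> p \<and> B \<in> p \<longrightarrow> A \<inter> B \<in> p) \<and>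
     (\<forall>A. A \<in> p \<or> - A \<in> p)"

text \<open>Points of the Stone-Cech compactification of the discrete space \<open>S\<close>.\<close>

definition beta_points :: "'a set set set" where
  "beta_points = {p. is_ultrafilter p}"

definition uf_plus :: "'a::semigroup_add set set \<Rightarrow> 'a set set \<Rightarrow> 'a set set" where
  "uf_plus p q = {A. {x. {y. x + y \<in> A} \<in> q} \<in> p}"

definition beta_family :: "'a set set \<Rightarrow> 'a set set set" where
  "beta_family F = {p \<in> beta_points. p \<subseteq> F}"

text \<open>
  Used with \<open>T = beta_family F\<close>. Non-emptiness is part of the notion; for a family with
  the Ramsey property it holds automatically.
\<close>

definition beta_subsemigroup :: "'a::semigroup_add set set set \<Rightarrow> bool" where
  "beta_subsemigroup T \<longleftrightarrow>
     T \<noteq> {} \<and> T \<subseteq> beta_points \<and> (\<forall>p\<in>T. \<forall>q\<in>T. uf_plus p q \<in> T)"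

definition essential_star_set :: "'a::semigroup_add set set \<Rightarrow> 'a set \<Rightarrow> bool" where
  "essential_star_set F A \<longleftrightarrow> (\<forall>p\<in>beta_family F. uf_plus p p = p \<longrightarrow> A \<in> p)"

text \<open>
  There is no neutral element, so sums and products are folds over non-empty lists;
  the value on the empty list is irrelevant and never used.
\<close>

definition fold_nonempty :: "('a \<Rightarrow> 'a \<Rightarrow> 'a) \<Rightarrow> 'a list \<Rightarrow> 'a" where
  "fold_nonempty f xs = foldl f (hd xs) (tl xs)"

definition ordered_sum :: "(nat \<Rightarrow> 'a::semigroup_add) \<Rightarrow> nat set \<Rightarrow> 'a" where
  "ordered_sum x H = fold_nonempty (+) (map x (sorted_list_of_set H))"

text \<open>Sequences are indexed from \<open>0\<close> rather than from \<open>1\<close>.\<close>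

definition FS :: "(nat \<Rightarrow> 'a::semigroup_add) \<Rightarrow> nat \<Rightarrow> 'a set" where
  "FS x m = {ordered_sum x H | H. finite H \<and> H \<noteq> {} \<and> H \<subseteq> {m..}}"

definition AP :: "(nat \<Rightarrow> 'a::semigroup_mult) \<Rightarrow> 'a set" where
  "AP x = {fold_nonempty (*) (map x ns) | ns. ns \<noteq> [] \<and> distinct ns}"

definition beta_cl :: "'a set \<Rightarrow> 'a set set set" where
  "beta_cl B = {p \<in> beta_points. B \<in> p}"

definition minimal_sequence :: "'a::semigroup_add set set \<Rightarrow> (nat \<Rightarrow> 'a) \<Rightarrow> bool" where
  "minimal_sequence F x \<longleftrightarrow> (\<Inter>m. beta_cl (FS x m)) \<inter> beta_family F \<noteq> {}"

definition sum_subsystem :: "(nat \<Rightarrow> 'a::semigroup_add) \<Rightarrow> (nat \<Rightarrow> 'a) \<Rightarrow> bool" where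
  "sum_subsystem y x \<longleftrightarrow>
     (\<exists>H :: nat \<Rightarrow> nat set.
        (\<forall>n. finite (H n) \<and> H n \<noteq> {}) \<and>
        (\<forall>n. Max (H n) < Min (H (Suc n))) \<and>
        (\<forall>n. y n = ordered_sum x (H n)))"

end

(* Compactness of the space of ultrafilters and the Ellis-Numakura argument give an idempotent p
   of beta(F) that contains every set of tail sums FS(x_m, x_{m+1}, ...). Multiplication by s on
   either side is additive, so it carries idempotents of beta(F) to idempotents of beta(F); hence
   preimages of essential F*-sets under left and right multiplications are again essential and
   belong to p. A Galvin-Hindman construction inside p then keeps sums in
   {s \<in> A. -s + A \<in> p} and adds a new factor a to an all-order product in one of the forms
   a, s a, a t, s a t, each of which lies in A for p-most a. *)
theory Submission
  imports Defs
begin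

section \<open>Ultrafilters and compactness\<close>

lemma is_ultrafilterD:
  assumes "is_ultrafilter p"
  shows "UNIV \<in> p" "{} \<notin> p"
    and "A \<in> p \<Longrightarrow> A \<subseteq> B \<Longrightarrow> B \<in> p"
    and "A \<in> p \<Longrightarrow> B \<in> p \<Longrightarrow> A \<inter> B \<in> p"
    and "A \<in> p \<or> - A \<in> p"
  using assms unfolding is_ultrafilter_def by blast+

lemma ultrafilter_Compl_iff: "is_ultrafilter p \<Longrightarrow> - A \<in> p \<longleftrightarrow> A \<notin> p"
  by (metis Compl_disjoint is_ultrafilterD(2,4,5))

lemma ultrafilter_Int_iff: "is_ultrafilter p \<Longrightarrow> A \<inter> B \<in> p \<longleftrightarrow> A \<in> p \<and> B \<in> p"
  by (meson Int_lower1 Int_lower2 is_ultrafilterD(3,4))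

lemma ultrafilter_Inter:
  assumes "is_ultrafilter p" "finite K" "K \<subseteq> p"
  shows "\<Inter>K \<in> p"
  using assms(2,3) by induction (auto intro: is_ultrafilterD[OF assms(1)])

lemma ultrafilter_subset_eq:
  assumes "is_ultrafilter p" "is_ultrafilter q" "p \<subseteq> q"
  shows "p = q"
  using assms by (metis subsetI subset_antisym subsetD ultrafilter_Compl_iff)

definition fip :: "'a set set \<Rightarrow> bool" where
  "fip E \<longleftrightarrow> (\<forall>K. finite K \<and> K \<subseteq> E \<longrightarrow> \<Inter>K \<noteq> {})"

lemma fipD: "fip E \<Longrightarrow> finite K \<Longrightarrow> K \<subseteq> E \<Longrightarrow> \<Inter>K \<noteq> {}"
  unfolding fip_def by blast

text \<open>If both extensions failed, the two finite witnesses, stripped of \<open>A\<close> and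
  \<open>- A\<close>, would lie in \<open>M\<close> and so share a point. That point is in
  \<open>A\<close> or in \<open>- A\<close>, hence in one of the supposedly empty
  intersections.\<close>

lemma fip_insert_cases:
  assumes "fip M"
  shows "fip (insert A M) \<or> fip (insert (- A) M)"
proof (rule ccontr)
  assume "\<not> ?thesis"
  then obtain K L where K: "finite K" "K \<subseteq> insert A M" "\<Inter>K = {}"
    and L: "finite L" "L \<subseteq> insert (- A) M" "\<Inter>L = {}"
    unfolding fip_def by blast
  have "\<Inter>((K - {A}) \<union> (L - {- A})) \<noteq> {}"
    using K L by (intro fipD[OF assms]) auto
  then obtain z where "z \<in> \<Inter>((K - {A}) \<union> (L - {- A}))" by blast
  then have "z \<in> \<Inter>K \<or> z \<in> \<Inter>L" by (cases "z \<in> A") auto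
  with K L show False by blast
qed

text \<open>Zorn yields a maximal collection above \<open>E\<close> with the finite intersection
  property. By \<open>fip_insert_cases\<close> it decides every set, and this forces the filter
  laws.\<close>

lemma ultrafilter_extends_fip:
  assumes "fip E"
  shows "\<exists>p. is_ultrafilter p \<and> E \<subseteq> p"
proof -
  have "\<exists>M\<in>{M. fip M \<and> E \<subseteq> M}. \<forall>X\<in>{M. fip M \<and> E \<subseteq> M}. M \<subseteq> X \<longrightarrow> X = M"
  proof (rule subset_Zorn_nonempty)
    fix C assume C: "C \<noteq> {}" "subset.chain {M. fip M \<and> E \<subseteq> M} C"
    have "fip (\<Union>C)" unfolding fip_def
    proof (intro allI impI)
      fix K assume K: "finite K \<and> K \<subseteq> \<Union>C"
      then obtain B where B: "B \<in> C" "K \<subseteq> B"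
        using finite_subset_Union_chain[OF _ _ C] by blast
      then have "fip B" using C(2) unfolding subset_chain_def by blast
      then show "\<Inter>K \<noteq> {}" using fipD K B(2) by metis
    qed
    then show "\<Union>C \<in> {M. fip M \<and> E \<subseteq> M}"
      using C unfolding subset_chain_def by blast
  qed (use assms in auto)
  then obtain M where M_mem: "M \<in> {M. fip M \<and> E \<subseteq> M}"
    and M_max: "\<forall>X\<in>{M. fip M \<and> E \<subseteq> M}. M \<subseteq> X \<longrightarrow> X = M"
    by (rule bexE)
  have M: "fip M" "E \<subseteq> M" using M_mem by auto
  have max: "X = M" if "fip X" "E \<subseteq> X" "M \<subseteq> X" for X using M_max that by simp
  have dich: "A \<in> M \<or> - A \<in> M" for A
    using fip_insert_cases[OF M(1), of A] max M(2) by (metis insertI1 subset_insertI subset_trans)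
  have no_empty: "{} \<notin> M" using fipD[OF M(1), of "{{}}"] by auto
  \<comment> \<open>If \<open>B\<close> were missing, \<open>- B\<close> would belong to
    \<open>M\<close> although it is disjoint from \<open>A\<close>. Closure under intersection
    follows in the same way.\<close>
  have up: "B \<in> M" if "A \<in> M" "A \<subseteq> B" for A B
    using fipD[OF M(1), of "{A, - B}"] dich[of B] that by auto
  have int: "A \<inter> B \<in> M" if "A \<in> M" "B \<in> M" for A B
    using fipD[OF M(1), of "{A, B, - (A \<inter> B)}"] dich[of "A \<inter> B"] that by auto
  have "is_ultrafilter M"
    unfolding is_ultrafilter_def using dich no_empty up int dich[of UNIV] by auto
  then show ?thesis using M(2) by blast
qed

text \<open>The closed subsets of \<open>\<beta>S\<close> are exactly the sets of this form.\<close>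

definition uf_hull :: "'a set set \<Rightarrow> 'a set set set" where
  "uf_hull G = {p. is_ultrafilter p \<and> G \<subseteq> p}"

text \<open>This is compactness of \<beta>S: an ultrafilter around a finite \<open>K\<close>
  contains \<open>\<Inter>K\<close>, which is therefore non-empty, so \<open>E\<close> has the
  finite intersection property.\<close>

lemma uf_hull_compact:
  assumes "\<And>K. finite K \<Longrightarrow> K \<subseteq> E \<Longrightarrow> uf_hull K \<noteq> {}"
  shows "uf_hull E \<noteq> {}"
proof -
  have "fip E" unfolding fip_def
  proof (intro allI impI)
    fix K assume K: "finite K \<and> K \<subseteq> E"
    then obtain p where "is_ultrafilter p" "K \<subseteq> p" using assms[of K] by (auto simp: uf_hull_def)
    then show "\<Inter>K \<noteq> {}" using ultrafilter_Inter K is_ultrafilterD(2) by metis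
  qed
  then show ?thesis using ultrafilter_extends_fip unfolding uf_hull_def by blast
qed

section \<open>Addition of ultrafilters\<close>

text \<open>Because \<open>q\<close> is an ultrafilter, sending \<open>A\<close> to
  \<open>{x. {y. x + y \<in> A} \<in> q}\<close> respects intersections, complements and inclusions,
  so the ultrafilter laws pull back from \<open>p\<close>.\<close>

lemma is_ultrafilter_uf_plus:
  assumes p: "is_ultrafilter p" and q: "is_ultrafilter q"
  shows "is_ultrafilter (uf_plus p q)"
proof -
  have int: "{x. {y. x + y \<in> A \<inter> B} \<in> q} = {x. {y. x + y \<in> A} \<in> q} \<inter> {x. {y. x + y \<in> B} \<in> q}"
    for A B
    using ultrafilter_Int_iff[OF q, of "{y. _ + y \<in> A}" "{y. _ + y \<in> B}"]
    by (simp add: Collect_conj_eq)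
  have compl: "{x. {y. x + y \<in> - A} \<in> q} = - {x. {y. x + y \<in> A} \<in> q}" for A
    using ultrafilter_Compl_iff[OF q] by (simp add: Collect_neg_eq)
  have up: "{x. {y. x + y \<in> B} \<in> q} \<in> p" if "{x. {y. x + y \<in> A} \<in> q} \<in> p" "A \<subseteq> B" for A B
    using that(1) by (rule is_ultrafilterD(3)[OF p])
      (use that(2) in \<open>auto elim!: is_ultrafilterD(3)[OF q]\<close>)
  show ?thesis
    unfolding is_ultrafilter_def uf_plus_def mem_Collect_eq int compl
      ultrafilter_Int_iff[OF p] ultrafilter_Compl_iff[OF p]
    using is_ultrafilterD[OF p] is_ultrafilterD[OF q] up by auto
qed

lemma uf_plus_assoc: "uf_plus (uf_plus p q) r = uf_plus p (uf_plus q r)"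
  unfolding uf_plus_def by (simp add: add.assoc)

text \<open>Right translation by \<open>p\<close> is continuous on the compact space \<beta>S, so
  the image of a closed set is closed; the hypothesis \<open>sub\<close> says that \<open>r\<close>
  lies in the closure of that image.\<close>

lemma Inter_image_preimage_uf_plus:
  assumes p: "is_ultrafilter p" and r: "is_ultrafilter r"
    and sub: "(\<Inter>q\<in>uf_hull G. uf_plus q p) \<subseteq> r"
  shows "\<exists>q\<in>uf_hull G. uf_plus q p = r"
proof -
  define \<rho> where "\<rho> B = {x. {y. x + y \<in> B} \<in> p}" for B
  have \<rho>_compl: "\<rho> (- B) = - \<rho> B" for B
    unfolding \<rho>_def using ultrafilter_Compl_iff[OF p] by (simp add: Collect_neg_eq)
  have \<rho>_mono: "\<rho> B \<subseteq> \<rho> B'" if "B \<subseteq> B'" for B B'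
    unfolding \<rho>_def using that by (auto elim!: is_ultrafilterD(3)[OF p])
  \<comment> \<open>An ultrafilter \<open>q\<close> contains every \<open>\<rho> B\<close> with
    \<open>B \<in> r\<close> exactly when \<open>r \<subseteq> uf_plus q p\<close>, so a point of
    this hull is the required preimage.\<close>
  have "uf_hull (G \<union> \<rho> ` r) \<noteq> {}"
  proof (rule uf_hull_compact)
    fix K assume K: "finite K" "K \<subseteq> G \<union> \<rho> ` r"
    then have "finite (K - G)" "K - G \<subseteq> \<rho> ` r" by auto
    then obtain R where R: "finite R" "R \<subseteq> r" "K - G = \<rho> ` R"
      by (meson finite_subset_image)
    \<comment> \<open>As \<rho> is monotone, the single set \<open>\<Inter>R\<close> can stand for
      all of \<open>R\<close>. If no \<open>q\<close> contained its image under \<rho>, every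
      \<open>uf_plus q p\<close> would contain \<open>- \<Inter>R\<close>, and by \<open>sub\<close>
      so would \<open>r\<close>.\<close>
    have B: "\<Inter>R \<in> r" using ultrafilter_Inter[OF r R(1,2)] .
    have "\<exists>q\<in>uf_hull G. \<rho> (\<Inter>R) \<in> q"
    proof (rule ccontr)
      assume "\<not> ?thesis"
      then have "- \<Inter>R \<in> uf_plus q p" if "q \<in> uf_hull G" for q
        using that ultrafilter_Compl_iff[of q] \<rho>_compl[of "\<Inter>R"]
        unfolding uf_hull_def uf_plus_def \<rho>_def by auto
      then have "- \<Inter>R \<in> r" using sub by blast
      with B show False using ultrafilter_Compl_iff[OF r] by blast
    qed
    then obtain q where q: "q \<in> uf_hull G" "\<rho> (\<Inter>R) \<in> q" by blast
    have "\<rho> B \<in> q" if "B \<in> R" for B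
      using q that \<rho>_mono[of "\<Inter>R" B] is_ultrafilterD(3) unfolding uf_hull_def by blast
    then have "\<rho> ` R \<subseteq> q" by (rule image_subsetI)
    then have "q \<in> uf_hull K" using q(1) unfolding uf_hull_def R(3)[symmetric] by auto
    then show "uf_hull K \<noteq> {}" by blast
  qed
  then obtain q where q: "is_ultrafilter q" "G \<subseteq> q" "\<rho> ` r \<subseteq> q" unfolding uf_hull_def by blast
  have "r \<subseteq> uf_plus q p" using q(3) unfolding uf_plus_def \<rho>_def by blast
  then have "uf_plus q p = r"
    using ultrafilter_subset_eq r is_ultrafilter_uf_plus[OF q(1) p] by metis
  with q show ?thesis unfolding uf_hull_def by blast
qed

text \<open>Ellis-Numakura for closed subsemigroups of \<beta>S: in a minimal one, every element
  turns out to be idempotent.\<close>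

theorem uf_hull_idempotent:
  assumes ne: "uf_hull G \<noteq> {}"
    and semi: "\<And>p q. p \<in> uf_hull G \<Longrightarrow> q \<in> uf_hull G \<Longrightarrow> uf_plus p q \<in> uf_hull G"
  shows "\<exists>p\<in>uf_hull G. uf_plus p p = p"
proof -
  \<comment> \<open>Closed subsemigroups are represented by collections of sets. Larger collections
    have smaller hulls, so a maximal member of \<open>Z\<close> is a minimal closed
    subsemigroup.\<close>
  define Z where "Z = {M. G \<subseteq> M \<and> uf_hull M \<noteq> {} \<and>
    (\<forall>p\<in>uf_hull M. \<forall>q\<in>uf_hull M. uf_plus p q \<in> uf_hull M)}"
  have "\<exists>M\<in>Z. \<forall>X\<in>Z. M \<subseteq> X \<longrightarrow> X = M"
  proof (rule subset_Zorn_nonempty)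
    show "Z \<noteq> {}" using ne semi unfolding Z_def by blast
    fix C assume C: "C \<noteq> {}" "subset.chain Z C"
    then have CZ: "\<And>M. M \<in> C \<Longrightarrow> M \<in> Z" unfolding subset_chain_def by blast
    have hull_iff: "p \<in> uf_hull (\<Union>C) \<longleftrightarrow> (\<forall>M\<in>C. p \<in> uf_hull M)" for p
      using C(1) unfolding uf_hull_def by blast
    \<comment> \<open>This hull is the intersection of the hulls along the chain; compactness keeps
      it non-empty.\<close>
    have "uf_hull (\<Union>C) \<noteq> {}"
    proof (rule uf_hull_compact)
      fix K assume "finite K" "K \<subseteq> \<Union>C"
      then obtain M where "M \<in> C" "K \<subseteq> M"
        using finite_subset_Union_chain[OF _ _ C] by blast
      then show "uf_hull K \<noteq> {}" using CZ unfolding Z_def uf_hull_def by blast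
    qed
    moreover have "G \<subseteq> \<Union>C" using C(1) CZ unfolding Z_def by blast
    moreover have "\<forall>p\<in>uf_hull (\<Union>C). \<forall>q\<in>uf_hull (\<Union>C). uf_plus p q \<in> uf_hull (\<Union>C)"
    proof (intro ballI)
      fix p q assume "p \<in> uf_hull (\<Union>C)" "q \<in> uf_hull (\<Union>C)"
      then show "uf_plus p q \<in> uf_hull (\<Union>C)"
        unfolding hull_iff using CZ by (simp add: Z_def)
    qed
    ultimately show "\<Union>C \<in> Z" unfolding Z_def by blast
  qed
  then obtain M where MZ: "M \<in> Z" and M_max: "\<forall>X\<in>Z. M \<subseteq> X \<longrightarrow> X = M" by (rule bexE)
  have max: "X = M" if "X \<in> Z" "M \<subseteq> X" for X using M_max that by simp
  from MZ have GM: "G \<subseteq> M" and M_ne: "uf_hull M \<noteq> {}"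
    and M_semi: "\<And>p q. p \<in> uf_hull M \<Longrightarrow> q \<in> uf_hull M \<Longrightarrow> uf_plus p q \<in> uf_hull M"
    unfolding Z_def by auto
  obtain p where p: "p \<in> uf_hull M" using M_ne by blast
  then have p_uf: "is_ultrafilter p" unfolding uf_hull_def by blast

  \<comment> \<open>The sets common to all \<open>uf_plus q p\<close> describe the translate of the
    minimal subsemigroup by \<open>p\<close>, which is closed by the previous lemma. Minimality
    makes the translate everything, so \<open>p\<close> itself has the form
    \<open>uf_plus q p\<close>.\<close>
  define M' where "M' = (\<Inter>q\<in>uf_hull M. uf_plus q p)"
  have hull_M': "uf_hull M' = (\<lambda>q. uf_plus q p) ` uf_hull M"
  proof
    show "uf_hull M' \<subseteq> (\<lambda>q. uf_plus q p) ` uf_hull M"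
      using Inter_image_preimage_uf_plus[OF p_uf] unfolding M'_def uf_hull_def by blast
    show "(\<lambda>q. uf_plus q p) ` uf_hull M \<subseteq> uf_hull M'"
      using is_ultrafilter_uf_plus[OF _ p_uf] unfolding M'_def uf_hull_def by blast
  qed
  have MM': "M \<subseteq> M'" using M_semi p unfolding M'_def uf_hull_def by blast
  \<comment> \<open>Reassociated, the sum is a translate by \<open>p\<close> of an element of
    \<open>uf_hull M\<close>.\<close>
  have "uf_plus (uf_plus q p) (uf_plus q' p) \<in> uf_hull M'"
    if "q \<in> uf_hull M" "q' \<in> uf_hull M" for q q'
    unfolding hull_M' using that M_semi p by (auto simp flip: uf_plus_assoc)
  then have "M' \<in> Z" using MM' GM M_ne by (auto simp: Z_def hull_M')
  then have "M' = M" using max MM' by blast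
  then have "p \<in> (\<lambda>q. uf_plus q p) ` uf_hull M" using hull_M' p by simp
  then obtain q where q: "q \<in> uf_hull M" "uf_plus q p = p" by force

  \<comment> \<open>The added sets express \<open>p \<subseteq> uf_plus r p\<close>, which for
    ultrafilters is equality. So the hull is the closed subsemigroup of left identities of
    \<open>p\<close>, inhabited by \<open>q\<close>; minimality puts \<open>p\<close> into
    it.\<close>
  define M'' where "M'' = M \<union> (\<lambda>B. {x. {y. x + y \<in> B} \<in> p}) ` p"
  have hull_M'': "r \<in> uf_hull M'' \<longleftrightarrow> r \<in> uf_hull M \<and> uf_plus r p = p" for r
  proof -
    have "r \<in> uf_hull M'' \<longleftrightarrow> r \<in> uf_hull M \<and> p \<subseteq> uf_plus r p"
      unfolding M''_def uf_hull_def uf_plus_def by blast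
    then show ?thesis
      using ultrafilter_subset_eq p_uf is_ultrafilter_uf_plus[OF _ p_uf, of r]
      unfolding uf_hull_def by blast
  qed
  have "M'' \<in> Z"
    unfolding Z_def
  proof (intro CollectI conjI ballI)
    show "G \<subseteq> M''" using GM unfolding M''_def by blast
    show "uf_hull M'' \<noteq> {}" using q hull_M'' by blast
    show "uf_plus r s \<in> uf_hull M''" if "r \<in> uf_hull M''" "s \<in> uf_hull M''" for r s
      using that M_semi by (simp add: hull_M'' uf_plus_assoc)
  qed
  then have "M'' = M" using max unfolding M''_def by blast
  then have "uf_plus p p = p" using hull_M'' p by blast
  then show ?thesis using p GM unfolding uf_hull_def by blast
qed

section \<open>Sums along increasing indices\<close>

lemma fold_nonempty_singleton: "fold_nonempty f [a] = a"
  unfolding fold_nonempty_def by simp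

text \<open>Placed in the locale \<open>semigroup\<close> so that one proof serves both addition and
  multiplication.\<close>

lemma (in semigroup) fold_nonempty_append:
  assumes "us \<noteq> []" "vs \<noteq> []"
  shows "fold_nonempty f (us @ vs) = f (fold_nonempty f us) (fold_nonempty f vs)"
proof -
  have "foldl f (f a b) ws = f a (foldl f b ws)" for a b ws
    by (induction ws arbitrary: b) (simp_all add: assoc)
  then show ?thesis
    using assms by (cases vs) (simp_all add: fold_nonempty_def)
qed

text \<open>Addition may fail to commute, so sums are split only where one index set lies wholly
  below the other and the sorted lists concatenate.\<close>

lemma sorted_list_of_set_Un:
  fixes H K :: "'a::linorder set"
  assumes "finite H" "finite K" "\<And>h k. h \<in> H \<Longrightarrow> k \<in> K \<Longrightarrow> h < k"
  shows "sorted_list_of_set (H \<union> K) = sorted_list_of_set H @ sorted_list_of_set K"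
proof (rule sorted_distinct_set_unique)
  show "sorted (sorted_list_of_set H @ sorted_list_of_set K)"
    using assms by (auto simp: sorted_append less_imp_le)
  show "distinct (sorted_list_of_set H @ sorted_list_of_set K)"
    using assms by fastforce
qed (use assms in auto)

lemma ordered_sum_Un:
  assumes "finite H" "finite K" "H \<noteq> {}" "K \<noteq> {}" "\<And>h k. h \<in> H \<Longrightarrow> k \<in> K \<Longrightarrow> h < k"
  shows "ordered_sum x (H \<union> K) = ordered_sum x H + ordered_sum x K"
  unfolding ordered_sum_def using assms
  by (simp add: sorted_list_of_set_Un add.fold_nonempty_append)

lemma ordered_sum_singleton: "ordered_sum x {n} = x n"
  unfolding ordered_sum_def by (simp add: fold_nonempty_singleton)

lemma ordered_sum_cong:
  assumes "finite H" "\<And>i. i \<in> H \<Longrightarrow> x i = y i"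
  shows "ordered_sum x H = ordered_sum y H"
proof -
  have "map x (sorted_list_of_set H) = map y (sorted_list_of_set H)"
    using assms by auto
  then show ?thesis unfolding ordered_sum_def by (rule arg_cong)
qed

text \<open>A sum over \<open>H\<close> can be prolonged by any sum whose indices start after
  \<open>Max H\<close>.\<close>

lemma FS_shift:
  assumes "s \<in> FS x m"
  shows "\<exists>k. FS x k \<subseteq> {y. s + y \<in> FS x m}"
proof -
  obtain H where H: "finite H" "H \<noteq> {}" "H \<subseteq> {m..}" "s = ordered_sum x H"
    using assms unfolding FS_def by blast
  have "s + ordered_sum x K \<in> FS x m"
    if K: "finite K" "K \<noteq> {}" "K \<subseteq> {Suc (Max H)..}" for K
  proof -
    have lt: "h < k" if "h \<in> H" "k \<in> K" for h k
    proof -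
      have "h \<le> Max H" using H(1) that(1) by simp
      moreover have "Suc (Max H) \<le> k" using K(3) that(2) by auto
      ultimately show ?thesis by simp
    qed
    have "m \<le> k" if "k \<in> K" for k
    proof -
      obtain h where "h \<in> H" using H(2) by blast
      then show ?thesis using lt[OF _ that] H(3) by fastforce
    qed
    then have "H \<union> K \<subseteq> {m..}" using H(3) by auto
    moreover have "s + ordered_sum x K = ordered_sum x (H \<union> K)"
      using H K lt by (simp add: ordered_sum_Un)
    ultimately show ?thesis unfolding FS_def using H(1,2) K(1) by blast
  qed
  then have "FS x (Suc (Max H)) \<subseteq> {y. s + y \<in> FS x m}"
    by (auto simp: FS_def[of x "Suc (Max H)"])
  then show ?thesis ..
qed

text \<open>For each \<open>s\<close> in \<open>FS x m\<close> the shifted set contains a tail and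
  so belongs to \<open>q\<close>. Hence the ultrafilters containing all tails are closed under
  addition.\<close>

lemma FS_mem_uf_plus:
  assumes p: "is_ultrafilter p" "\<And>m. FS x m \<in> p"
    and q: "is_ultrafilter q" "\<And>m. FS x m \<in> q"
  shows "FS x m \<in> uf_plus p q"
proof -
  have "FS x m \<subseteq> {s. {y. s + y \<in> FS x m} \<in> q}"
    using FS_shift is_ultrafilterD(3)[OF q(1) q(2)] by blast
  then show ?thesis
    unfolding uf_plus_def using is_ultrafilterD(3)[OF p(1) p(2)] by blast
qed

lemma minimal_sequence_idempotent:
  assumes "beta_subsemigroup (beta_family F)" "minimal_sequence F x"
  shows "\<exists>p\<in>beta_family F. uf_plus p p = p \<and> (\<forall>m. FS x m \<in> p)"
proof -
  \<comment> \<open>An ultrafilter contains the complement of every set outside \<open>F\<close>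
    exactly when it is a subset of \<open>F\<close>. Thus the points of \<beta>(F) containing all
    tails form a hull, to which \<open>uf_hull_idempotent\<close> applies.\<close>
  define G where "G = range (FS x) \<union> uminus ` (- F)"
  have sub: "uminus ` (- F) \<subseteq> p \<longleftrightarrow> p \<subseteq> F" if "is_ultrafilter p" for p
    using ultrafilter_Compl_iff[OF that] by blast
  have hull: "p \<in> uf_hull G \<longleftrightarrow> p \<in> beta_family F \<and> (\<forall>m. FS x m \<in> p)" for p
  proof -
    have "p \<in> uf_hull G \<longleftrightarrow> is_ultrafilter p \<and> range (FS x) \<subseteq> p \<and> uminus ` (- F) \<subseteq> p"
      unfolding uf_hull_def G_def by simp
    also have "\<dots> \<longleftrightarrow> is_ultrafilter p \<and> range (FS x) \<subseteq> p \<and> p \<subseteq> F"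
      using sub by (rule conj_cong[OF refl conj_cong[OF refl]])
    also have "\<dots> \<longleftrightarrow> p \<in> beta_family F \<and> (\<forall>m. FS x m \<in> p)"
      by (auto simp: beta_family_def beta_points_def)
    finally show ?thesis .
  qed
  have "\<exists>p\<in>uf_hull G. uf_plus p p = p"
  proof (rule uf_hull_idempotent)
    show "uf_hull G \<noteq> {}"
      using assms(2) hull unfolding minimal_sequence_def beta_cl_def by blast
    show "uf_plus p q \<in> uf_hull G" if "p \<in> uf_hull G" "q \<in> uf_hull G" for p q
    proof -
      have mem: "p \<in> beta_family F" "q \<in> beta_family F" "\<And>m. FS x m \<in> p" "\<And>m. FS x m \<in> q"
        using that by (simp_all add: hull)
      then have "is_ultrafilter p" "is_ultrafilter q"
        by (simp_all add: beta_family_def beta_points_def)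
      then have "\<forall>m. FS x m \<in> uf_plus p q" using mem FS_mem_uf_plus by metis
      moreover have "uf_plus p q \<in> beta_family F"
        using assms(1) mem by (simp add: beta_subsemigroup_def)
      ultimately show ?thesis by (simp add: hull)
    qed
  qed
  then show ?thesis using hull by blast
qed

section \<open>Essential sets and dilations\<close>

text \<open>The image \<open>q\<close> of an idempotent \<open>p\<close> under the additive map
  \<open>g\<close> is again idempotent and contained in \<open>F\<close>, so \<open>A\<close>
  belongs to \<open>q\<close>.\<close>

lemma essential_star_set_vimage:
  assumes F: "is_family F" "\<And>E. E \<in> F \<Longrightarrow> g ` E \<in> F"
    and hom: "\<And>a b. g (a + b) = g a + g b"
    and A: "essential_star_set F A"
  shows "essential_star_set F (g -` A)"
  unfolding essential_star_set_def
proof (intro ballI impI)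
  fix p assume p: "p \<in> beta_family F" "uf_plus p p = p"
  define q where "q = {B. g -` B \<in> p}"
  have p_uf: "is_ultrafilter p" and pF: "p \<subseteq> F"
    using p(1) unfolding beta_family_def beta_points_def by auto
  have q_uf: "is_ultrafilter q"
    unfolding is_ultrafilter_def q_def mem_Collect_eq vimage_Int vimage_Compl
      ultrafilter_Int_iff[OF p_uf] ultrafilter_Compl_iff[OF p_uf]
    using is_ultrafilterD(1,2)[OF p_uf] is_ultrafilterD(3)[OF p_uf _ vimage_mono] by auto
  have "q \<subseteq> F"
  proof
    fix B assume "B \<in> q"
    \<comment> \<open>This image is a subset of \<open>B\<close>, so upward closure of
      \<open>F\<close> finishes.\<close>
    then have "g ` (g -` B) \<in> F" using pF F(2) unfolding q_def by blast
    then show "B \<in> F" using F(1) unfolding is_family_def by blast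
  qed
  moreover have "uf_plus q q = q"
  proof -
    have "B \<in> uf_plus q q \<longleftrightarrow> g -` B \<in> uf_plus p p" for B
      unfolding uf_plus_def q_def by (simp add: vimage_def hom)
    then show ?thesis unfolding p(2) q_def by blast
  qed
  ultimately have "A \<in> q"
    using A q_uf unfolding essential_star_set_def beta_family_def beta_points_def by blast
  then show "g -` A \<in> p" unfolding q_def by simp
qed

lemma essential_star_set_dilations:
  fixes F :: "'a::weak_ring set set"
  assumes "is_family F" "dilation_invariant F" "essential_star_set F A"
  shows "essential_star_set F {a. s * a \<in> A}" "essential_star_set F {a. a * s \<in> A}"
proof -
  have "essential_star_set F ((\<lambda>a. s * a) -` A)" "essential_star_set F ((\<lambda>a. a * s) -` A)"
    using assms unfolding dilation_invariant_def
    by (intro essential_star_set_vimage;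
        simp add: weak_ring_distrib_left weak_ring_distrib_right)+
  then show "essential_star_set F {a. s * a \<in> A}" "essential_star_set F {a. a * s \<in> A}"
    unfolding vimage_def .
qed

section \<open>The inductive construction\<close>

text \<open>The set usually written with a star on \<open>A\<close> in proofs of Hindman's theorem
  by idempotents.\<close>

definition star_part :: "'a::semigroup_add set set \<Rightarrow> 'a set \<Rightarrow> 'a set" where
  "star_part p A = {s \<in> A. {y. s + y \<in> A} \<in> p}"

lemma star_part_mem:
  assumes "is_ultrafilter p" "uf_plus p p = p" "A \<in> p"
  shows "star_part p A \<in> p"
proof -
  have "A \<in> uf_plus p p" using assms by simp
  then have "A \<inter> {s. {y. s + y \<in> A} \<in> p} \<in> p"
    unfolding uf_plus_def using assms by (simp add: ultrafilter_Int_iff)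
  then show ?thesis unfolding star_part_def by (simp add: Int_def)
qed

text \<open>By associativity, taking the star part commutes with the shift by \<open>s\<close>, so
  \<open>star_part_mem\<close> applies to the shifted set.\<close>

lemma star_part_shift_mem:
  assumes "is_ultrafilter p" "uf_plus p p = p" "s \<in> star_part p A"
  shows "{y. s + y \<in> star_part p A} \<in> p"
proof -
  have "{y. s + y \<in> A} \<in> p" using assms(3) unfolding star_part_def by blast
  then have "star_part p {y. s + y \<in> A} \<in> p" by (rule star_part_mem[OF assms(1,2)])
  then show ?thesis unfolding star_part_def by (simp add: add.assoc)
qed

text \<open>Only the values of \<open>h\<close> below \<open>n\<close> matter.\<close>

definition good_blocks ::
  "(nat \<Rightarrow> 'a::weak_ring) \<Rightarrow> 'a set \<Rightarrow> 'a set \<Rightarrow> nat \<Rightarrow> (nat \<Rightarrow> nat set) \<Rightarrow> bool" where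
  "good_blocks x B A n h \<longleftrightarrow>
     (\<forall>i<n. finite (h i) \<and> h i \<noteq> {}) \<and>
     (\<forall>i<n. \<forall>j<i. Max (h j) < Min (h i)) \<and>
     (\<forall>I. finite I \<and> I \<noteq> {} \<and> I \<subseteq> {..<n} \<longrightarrow> ordered_sum (\<lambda>i. ordered_sum x (h i)) I \<in> B) \<and>
     (\<forall>ns. ns \<noteq> [] \<and> distinct ns \<and> set ns \<subseteq> {..<n} \<longrightarrow>
        fold_nonempty (*) (map (\<lambda>i. ordered_sum x (h i)) ns) \<in> A)"

lemma good_blocks_cong:
  assumes good: "good_blocks x B A n h" and eq: "\<And>i. i < n \<Longrightarrow> h i = h' i"
  shows "good_blocks x B A n h'"
proof -
  have sums: "ordered_sum (\<lambda>i. ordered_sum x (h' i)) I = ordered_sum (\<lambda>i. ordered_sum x (h i)) I"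
    if "finite I" "I \<subseteq> {..<n}" for I
    using that eq by (intro ordered_sum_cong) auto
  have prods: "map (\<lambda>i. ordered_sum x (h' i)) ns = map (\<lambda>i. ordered_sum x (h i)) ns"
    if "set ns \<subseteq> {..<n}" for ns
    using that eq by auto
  show ?thesis
    unfolding good_blocks_def
  proof (intro conjI allI impI; (elim conjE)?)
    show "finite (h' i)" "h' i \<noteq> {}" if "i < n" for i
      using good that by (simp_all add: good_blocks_def flip: eq)
    show "Max (h' j) < Min (h' i)" if "i < n" "j < i" for i j
      unfolding eq[OF that(1), symmetric] eq[OF less_trans[OF that(2,1)], symmetric]
      using good that unfolding good_blocks_def by blast
    show "ordered_sum (\<lambda>i. ordered_sum x (h' i)) I \<in> B"
      if "finite I" "I \<noteq> {}" "I \<subseteq> {..<n}" for I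
      using good that by (simp add: good_blocks_def sums)
    show "fold_nonempty (*) (map (\<lambda>i. ordered_sum x (h' i)) ns) \<in> A"
      if "ns \<noteq> []" "distinct ns" "set ns \<subseteq> {..<n}" for ns
      using good that unfolding prods[OF that(3)] by (simp add: good_blocks_def)
  qed
qed

lemma prefix_determined_choice:
  fixes P :: "nat \<Rightarrow> (nat \<Rightarrow> 'b) \<Rightarrow> bool"
  assumes init: "P 0 h0"
    and step: "\<And>n h. P n h \<Longrightarrow> \<exists>k. P (Suc n) (h(n := k))"
    and cong: "\<And>n h h'. P n h \<Longrightarrow> (\<And>i. i < n \<Longrightarrow> h i = h' i) \<Longrightarrow> P n h'"
  shows "\<exists>H. \<forall>n. P n H"
proof -
  have "\<exists>f. \<forall>n. P n (f n) \<and> (\<forall>i<n. f (Suc n) i = f n i)"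
  proof (rule dependent_nat_choice)
    show "\<exists>h. P 0 h" using init by blast
    show "\<exists>h'. P (Suc n) h' \<and> (\<forall>i<n. h' i = h i)" if "P n h" for h n
      using step[OF that] by (metis fun_upd_other less_irrefl)
  qed
  then obtain f where f: "\<And>n. P n (f n)" "\<And>n i. i < n \<Longrightarrow> f (Suc n) i = f n i" by blast
  have "f n i = f (Suc i) i" if "i < n" for n i
    using that by (induction n) (auto simp: f(2) less_Suc_eq)
  \<comment> \<open>Stage \<open>i\<close> fixes only positions below \<open>i\<close>; the value at
    \<open>i\<close> is frozen from stage \<open>Suc i\<close> on, hence this diagonal.\<close>
  then have "P n (\<lambda>i. f (Suc i) i)" for n
    by (intro cong[OF f(1)])
  then show ?thesis by blast
qed

lemma good_blocks_step:
  fixes F :: "'a::weak_ring set set"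
  assumes F: "is_family F" "dilation_invariant F" "essential_star_set F A"
    and p: "p \<in> beta_family F" "uf_plus p p = p" "\<And>m. FS x m \<in> p"
    and good: "good_blocks x (star_part p A) A n h"
  shows "\<exists>k. good_blocks x (star_part p A) A (Suc n) (h(n := k))"
proof -
  let ?B = "star_part p A"
  define y where "y i = ordered_sum x (h i)" for i
  define U where "U = ordered_sum y ` {I. I \<noteq> {} \<and> I \<subseteq> {..<n}}"
  define V where "V = (\<lambda>ns. fold_nonempty (*) (map y ns)) `
    {ns. ns \<noteq> [] \<and> distinct ns \<and> set ns \<subseteq> {..<n}}"
  have p_uf: "is_ultrafilter p" using p(1) unfolding beta_family_def beta_points_def by blast
  have ess: "C \<in> p" if "essential_star_set F C" for C
    using that p unfolding essential_star_set_def by blast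
  have blocks: "finite (h i)" "h i \<noteq> {}" if "i < n" for i
    using good that unfolding good_blocks_def by auto
  have UB: "U \<subseteq> ?B"
    unfolding U_def
  proof (rule image_subsetI)
    fix I assume "I \<in> {I. I \<noteq> {} \<and> I \<subseteq> {..<n}}"
    moreover from this have "finite I" using finite_subset[of I "{..<n}"] by simp
    ultimately show "ordered_sum y I \<in> ?B" using good by (simp add: good_blocks_def y_def[abs_def])
  qed
  have VA: "V \<subseteq> A"
    unfolding V_def
    by (rule image_subsetI) (use good in \<open>simp add: good_blocks_def y_def[abs_def]\<close>)
  have "finite {I. I \<noteq> {} \<and> I \<subseteq> {..<n}}" by (rule finite_subset[of _ "Pow {..<n}"]) auto
  then have finU: "finite U" unfolding U_def by simp
  have "finite {ns. ns \<noteq> [] \<and> distinct ns \<and> set ns \<subseteq> {..<n}}"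
    by (rule finite_subset[OF _ finite_subset_distinct[of "{..<n}"]]) auto
  then have finV: "finite V" unfolding V_def by simp
  \<comment> \<open>Taking the next block from indices at or above \<open>M\<close> places it after
    all earlier blocks.\<close>
  obtain M where M: "\<And>i j. i < n \<Longrightarrow> j \<in> h i \<Longrightarrow> j < M"
  proof -
    have "finite (\<Union>i<n. h i)" using blocks by auto
    then obtain M where "\<And>j. j \<in> (\<Union>i<n. h i) \<Longrightarrow> j < M"
      unfolding finite_nat_set_iff_bounded by blast
    then show ?thesis using that by blast
  qed

  \<comment> \<open>All demands on the new term \<open>a\<close>: it is a late sum, it lies in the
    star part, it may follow any old sum, and it may stand after, before or between old
    products.\<close>
  define K where "K = {FS x M, ?B} \<union> (\<lambda>u. {a. u + a \<in> ?B}) ` U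
    \<union> (\<lambda>v. {a. v * a \<in> A}) ` V \<union> (\<lambda>v. {a. a * v \<in> A}) ` V
    \<union> (\<lambda>(v, w). {a. v * a * w \<in> A}) ` (V \<times> V)"
  have "finite K" unfolding K_def using finU finV by auto
  moreover have "K \<subseteq> p"
  proof -
    have "?B \<in> p" using star_part_mem[OF p_uf p(2) ess[OF F(3)]] .
    moreover have "{a. u + a \<in> ?B} \<in> p" if "u \<in> U" for u
      using star_part_shift_mem[OF p_uf p(2)] that UB by blast
    moreover have "{a. v * a \<in> A} \<in> p" "{a. a * v \<in> A} \<in> p" for v
      using ess essential_star_set_dilations[OF F] by blast+
    \<comment> \<open>The right dilation by \<open>w\<close> is applied to \<open>A\<close> first,
      then the left dilation by \<open>v\<close> to the resulting essential set.\<close>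
    moreover have "{a. v * a * w \<in> A} \<in> p" for v w
      using ess essential_star_set_dilations(1)
        [OF F(1,2) essential_star_set_dilations(2)[OF F, of w], of v] by simp
    ultimately show ?thesis unfolding K_def using p(3) by auto
  qed
  ultimately have "\<Inter>K \<in> p" using ultrafilter_Inter[OF p_uf] by blast
  then have "\<Inter>K \<noteq> {}" using is_ultrafilterD(2)[OF p_uf] by metis
  then obtain a where a: "a \<in> \<Inter>K" by blast
  have aFS: "a \<in> FS x M" and aB: "a \<in> ?B" using a unfolding K_def by auto
  have aU: "u + a \<in> ?B" if "u \<in> U" for u
  proof -
    have "{a. u + a \<in> ?B} \<in> K" unfolding K_def using that by simp
    then show ?thesis using a by blast
  qed
  have aV1: "v * a \<in> A" "a * v \<in> A" if "v \<in> V" for v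
  proof -
    have "{a. v * a \<in> A} \<in> K" "{a. a * v \<in> A} \<in> K" unfolding K_def using that by simp_all
    then show "v * a \<in> A" "a * v \<in> A" using a by blast+
  qed
  have aV2: "v * a * w \<in> A" if "v \<in> V" "w \<in> V" for v w
  proof -
    have "{a. v * a * w \<in> A} \<in> K" unfolding K_def using that by force
    then show ?thesis using a by blast
  qed
  have aA: "a \<in> A" using aB unfolding star_part_def by blast
  obtain k where k: "finite k" "k \<noteq> {}" "k \<subseteq> {M..}" "a = ordered_sum x k"
    using aFS unfolding FS_def by blast

  define h' where "h' = h(n := k)"
  define y' where "y' i = ordered_sum x (h' i)" for i
  have y'n: "y' n = a" and y'_less: "\<And>i. i < n \<Longrightarrow> y' i = y i"
    unfolding y'_def h'_def y_def k(4) by auto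
  have blocks': "finite (h' i)" "h' i \<noteq> {}" if "i < Suc n" for i
    using blocks k that unfolding h'_def by auto
  have sep: "Max (h' j) < Min (h' i)" if "i < Suc n" "j < i" for i j
  proof (cases "i = n")
    case True
    then have jn: "j < n" using that by simp
    then have "Max (h j) < M" using M blocks by simp
    also have "M \<le> Min k" using k by auto
    finally show ?thesis using True jn unfolding h'_def by simp
  next
    case False
    then have "i < n" using that by simp
    then have "Max (h j) < Min (h i)" using good that unfolding good_blocks_def by blast
    moreover have "h' j = h j" "h' i = h i" using \<open>i < n\<close> that unfolding h'_def by auto
    ultimately show ?thesis by (simp only:)
  qed
  have sums: "ordered_sum y' I \<in> ?B" if I: "finite I" "I \<noteq> {}" "I \<subseteq> {..<Suc n}" for I
  proof -
    \<comment> \<open>The index \<open>n\<close> exceeds all the others, so \<open>a\<close> comes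
      last in the ordered sum.\<close>
    define J where "J = I - {n}"
    have J: "finite J" "J \<subseteq> {..<n}" using I unfolding J_def by auto
    have J_sum: "ordered_sum y' J = ordered_sum y J"
      using J y'_less by (intro ordered_sum_cong) auto
    have J_U: "ordered_sum y J \<in> U" if "J \<noteq> {}" using J that unfolding U_def by blast
    consider "n \<notin> I" | "I = {n}" | "n \<in> I" "J \<noteq> {}" using J_def by blast
    then show ?thesis
    proof cases
      case 1
      then have "I = J" unfolding J_def by blast
      then show ?thesis using J_sum J_U I(2) UB by auto
    next
      case 2
      then show ?thesis using aB y'n by (simp add: ordered_sum_singleton)
    next
      case 3
      then have "I = J \<union> {n}" unfolding J_def by blast
      moreover have "ordered_sum y' (J \<union> {n}) = ordered_sum y' J + ordered_sum y' {n}"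
        using J 3 by (intro ordered_sum_Un) auto
      ultimately show ?thesis
        using aU[OF J_U[OF 3(2)]] by (simp add: ordered_sum_singleton y'n J_sum)
    qed
  qed
  have prods: "fold_nonempty (*) (map y' ns) \<in> A"
    if ns: "ns \<noteq> []" "distinct ns" "set ns \<subseteq> {..<Suc n}" for ns
  proof -
    have V: "fold_nonempty (*) (map y' ms) \<in> V"
      if "ms \<noteq> []" "distinct ms" "set ms \<subseteq> {..<n}" for ms
    proof -
      have eq: "map y' ms = map y ms" using that y'_less by auto
      show ?thesis unfolding eq V_def by (rule imageI) (use that in simp)
    qed
    show ?thesis
    proof (cases "n \<in> set ns")
      case False
      then have "set ns \<subseteq> {..<n}" using ns(3) less_Suc_eq by auto
      then show ?thesis using V ns VA by blast
    next
      case True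
      \<comment> \<open>By distinctness \<open>n\<close> occurs once, so the products over
        \<open>us\<close> and \<open>vs\<close>, when non-empty, use only old terms and lie in
        \<open>V\<close>.\<close>
      then obtain us vs where uv: "ns = us @ n # vs" by (meson split_list)
      then have us: "distinct us" "set us \<subseteq> {..<n}" and vs: "distinct vs" "set vs \<subseteq> {..<n}"
        using ns less_Suc_eq by auto
      let ?p = "\<lambda>ms. fold_nonempty (*) (map y' ms)"
      have app: "?p (ms @ ms') = ?p ms * ?p ms'" if "ms \<noteq> []" "ms' \<noteq> []" for ms ms'
        using that by (simp add: mult.fold_nonempty_append)
      have pn: "?p [n] = a" by (simp add: fold_nonempty_singleton y'n)
      have split: "ns = us @ [n] @ vs" using uv by simp
      consider "us = []" "vs = []" | "us = []" "vs \<noteq> []" | "us \<noteq> []" "vs = []"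
        | "us \<noteq> []" "vs \<noteq> []" by blast
      then show ?thesis
      proof cases
        case 1
        then show ?thesis using split pn aA by simp
      next
        case 2
        then have "?p ns = a * ?p vs" using split app[of "[n]" vs] pn by simp
        then show ?thesis using aV1(2) V[of vs] vs 2 by simp
      next
        case 3
        then have "?p ns = ?p us * a" using split app[of us "[n]"] pn by simp
        then show ?thesis using aV1(1) V[of us] us 3 by simp
      next
        case 4
        then have "?p ns = ?p us * a * ?p vs"
          using split app[of us "[n] @ vs"] app[of "[n]" vs] pn by (simp add: mult.assoc)
        then show ?thesis using aV2 V[of us] V[of vs] us vs 4 by simp
      qed
    qed
  qed
  have "good_blocks x ?B A (Suc n) h'"
    unfolding good_blocks_def using blocks' sep sums prods unfolding y'_def by blast
  then show ?thesis unfolding h'_def by blast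
qed

theorem theorem4p9:
  fixes F :: "'a::weak_ring set set"
    and x :: "nat \<Rightarrow> 'a"
    and A :: "'a set"
  assumes "is_family F"
    and "ramsey_property F"
    and "left_inverse_shift_invariant F"
    and "dilation_invariant F"
    and "beta_subsemigroup (beta_family F)"
    and "minimal_sequence F x"
    and "essential_star_set F A"
  shows "\<exists>y. sum_subsystem y x \<and> FS y 0 \<union> AP y \<subseteq> A"
proof -
  obtain p where p: "p \<in> beta_family F" "uf_plus p p = p" "\<And>m. FS x m \<in> p"
    using minimal_sequence_idempotent[OF assms(5,6)] by blast
  have "\<exists>H. \<forall>n. good_blocks x (star_part p A) A n H"
  proof (rule prefix_determined_choice)
    \<comment> \<open>At stage 0 every condition is vacuous, so the empty blocks are mere
      placeholders.\<close>
    show "good_blocks x (star_part p A) A 0 (\<lambda>_. {})"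
      unfolding good_blocks_def by auto
  qed (use good_blocks_step[OF assms(1,4,7) p] good_blocks_cong in blast)+
  then obtain H where H: "\<And>n. good_blocks x (star_part p A) A n H" by blast
  define y where "y i = ordered_sum x (H i)" for i
  have "sum_subsystem y x"
    unfolding sum_subsystem_def y_def
    using H unfolding good_blocks_def by (metis lessI)
  moreover have "FS y 0 \<subseteq> A"
  proof
    fix s assume "s \<in> FS y 0"
    then obtain I where I: "finite I" "I \<noteq> {}" "s = ordered_sum y I" unfolding FS_def by blast
    \<comment> \<open>A finite index set is already covered by some finite stage of the
      construction.\<close>
    then obtain n where "I \<subseteq> {..<n}"
      using finite_nat_set_iff_bounded by (metis lessThan_iff subsetI)
    then have "s \<in> star_part p A"
      using H[of n] I by (simp add: good_blocks_def y_def[abs_def])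
    then show "s \<in> A" unfolding star_part_def by blast
  qed
  moreover have "AP y \<subseteq> A"
  proof
    fix s assume "s \<in> AP y"
    then obtain ns where ns: "ns \<noteq> []" "distinct ns" "s = fold_nonempty (*) (map y ns)"
      unfolding AP_def by blast
    obtain n where "set ns \<subseteq> {..<n}"
      using finite_nat_set_iff_bounded[of "set ns"] by (metis List.finite_set lessThan_iff subsetI)
    then show "s \<in> A" using H[of n] ns by (simp add: good_blocks_def y_def[abs_def])
  qed
  ultimately show ?thesis by blast
qed

end
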